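(* Let $r\ge 1$, $0<c<1$, and let $\beta_1,\ldots,\beta_r>0$ satisfy $\beta_i-\beta_j\notin\mathbb{Z}$ whenever $i\neq j$. Let $M^{(2)}_{\vec n}$, $\vec n=(n_1,\ldots,n_r)\in\mathbb{N}^r$, be the multiple Meixner polynomials of the second kind with parameters $\beta_1,\ldots,\beta_r$ and $c$. Let $$A_2=\left\{(t_1,\ldots,t_r)\in\mathbb{R}_+^r: t_i<\left(\frac{1-c}{c}\right)^2,\ 1\le i\le r\right\}$$ and, for $1\le i\le r$, $$B_i=\left\{(t_1,\ldots,t_r)\in\mathbb{R}_+^r: t_i>(1-c)^2\right\}.$$ Then for every $(t_1,\ldots,t_r)\in A_2\cap\bigcup_{i=1}^rB_i$, $$\sum_{n_1=0}^\infty\cdots\sum_{n_r=0}^\infty\frac{[M^{(2)}_{\vec n}(x)]^2}{n_1!\cdots n_r!\,(\beta_1)_{n_1}\cdots(\beta_r)_{n_r}}\,t_1^{n_1}\cdots t_r^{n_r}\quad\begin{cases}<\infty,&\text{if }x\in\mathbb{N},\\=\infty,&\text{if }x\in\mathbb{R}\setminus\mathbb{N}.\end{cases}$$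
   Context: $\mathbb{N}=\{0,1,2,\ldots\}$ and $\mathbb{R}_+=(0,\infty)$. For $\vec n=(n_1,\ldots,n_r)\in\mathbb{N}^r$, $|\vec n|=n_1+\cdots+n_r$. The Pochhammer symbol is $(a)_0=1$, $(a)_k=a(a+1)\cdots(a+k-1)$. The multiple Meixner polynomial of the second kind $M^{(2)}_{\vec n}$ (with parameters $\beta_1,\ldots,\beta_r>0$, $\beta_i-\beta_j\notin\mathbb{Z}$ for $i\ne j$, and $0<c<1$) is the unique monic polynomial of degree $|\vec n|$ in one variable satisfying $$\sum_{k=0}^\infty M^{(2)}_{\vec n}(k)\,k^\ell\,\frac{(\beta_j)_k c^k}{k!}=0,\qquad \ell=0,1,\ldots,n_j-1,\quad j=1,\ldots,r.$$ *)

theory Defs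
  imports "HOL-Analysis.Analysis" "HOL-Computational_Algebra.Polynomial"
begin

(* Vectors with r components are functions on a finite index type, so r = CARD('r) >= 1. *)

definition is_multiple_meixner2 ::
  "('r::finite \<Rightarrow> real) \<Rightarrow> real \<Rightarrow> ('r \<Rightarrow> nat) \<Rightarrow> real poly \<Rightarrow> bool" where
  "is_multiple_meixner2 \<beta> c n p \<longleftrightarrow>
     degree p = (\<Sum>i\<in>UNIV. n i) \<and> lead_coeff p = 1 \<and>
     (\<forall>j. \<forall>l<n j.
        (\<lambda>k. poly p (real k) * real k ^ l * (pochhammer (\<beta> j) k * c ^ k / fact k)) sums 0)"

definition multiple_meixner2 ::
  "('r::finite \<Rightarrow> real) \<Rightarrow> real \<Rightarrow> ('r \<Rightarrow> nat) \<Rightarrow> real poly" where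
  "multiple_meixner2 \<beta> c n = (THE p. is_multiple_meixner2 \<beta> c n p)"

definition region_A2 :: "real \<Rightarrow> ('r::finite \<Rightarrow> real) set" where
  "region_A2 c = {t. (\<forall>i. 0 < t i) \<and> (\<forall>i. t i < ((1 - c) / c)\<^sup>2)}"

definition region_B :: "real \<Rightarrow> 'r::finite \<Rightarrow> ('r \<Rightarrow> real) set" where
  "region_B c i = {t. (\<forall>j. 0 < t j) \<and> t i > (1 - c)\<^sup>2}"

(* Every summand is nonnegative when all \<beta> i and t i are positive, so the embedding into
   ennreal truncates nothing, and the multiple series is the unordered sum over all
   multi-indices, with values in [0, \<infinity>]. *)
definition meixner2_series ::
  "('r::finite \<Rightarrow> real) \<Rightarrow> real \<Rightarrow> ('r \<Rightarrow> real) \<Rightarrow> real \<Rightarrow> ennreal" where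
  "meixner2_series \<beta> c t x =
     (\<Sum>\<^sub>\<infinity>n\<in>(UNIV :: ('r \<Rightarrow> nat) set).
        ennreal ((poly (multiple_meixner2 \<beta> c n) x)\<^sup>2
                 / ((\<Prod>i\<in>UNIV. fact (n i)) * (\<Prod>i\<in>UNIV. pochhammer (\<beta> i) (n i)))
                 * (\<Prod>i\<in>UNIV. t i ^ n i)))"

end

theory Submission
  imports Defs
begin

text \<open>Put \<open>T p (x) = x p(x) - (x / c) p(x - 1)\<close>. Against the weight \<open>(b)\<^sub>k c ^ k / k!\<close> the operator \<open>T\<close>
  acts as multiplication by \<open>-b\<close>, so the multiple Meixner polynomial is, up to normalization, \<open>q(T) 1\<close>
  for \<open>q(s) = \<Prod>\<^sub>i (\<beta>\<^sub>i + s) \<cdots> (\<beta>\<^sub>i + n\<^sub>i - 1 + s)\<close>: the moment conditions say that \<open>q\<close> vanishes at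
  the distinct points \<open>- \<beta>\<^sub>i - l\<close>, \<open>l < n\<^sub>i\<close>. At \<open>x \<in> \<nat>\<close> the functions \<open>binomial(x, m) c powr -x\<close> are
  eigenfunctions of \<open>T\<close> with eigenvalue \<open>m\<close>, which expands \<open>q(T) 1\<close> into \<open>x + 1\<close> values \<open>q(m)\<close> and bounds
  the series by a product of convergent one-index series. For \<open>x \<notin> \<nat>\<close> already the terms with a
  single nonzero index are unbounded, because the generating function
  \<open>(1 - z / c) powr x * (1 - z) powr (-x - b)\<close> is singular at \<open>z = c\<close>.\<close>

section \<open>The operator T and the polynomials q(T) 1\<close>

definition meixner_weight :: "real \<Rightarrow> real \<Rightarrow> nat \<Rightarrow> real" where
  "meixner_weight c b k = pochhammer b k * c ^ k / fact k"

definition meixner_raise :: "real \<Rightarrow> real poly \<Rightarrow> real poly" where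
  "meixner_raise c p = [:0, 1:] * p - smult (1 / c) ([:0, 1:] * pcompose p [:-1, 1:])"

text \<open>\<open>meixner_op c q\<close> is \<open>q(T) 1\<close>, evaluated by Horner's scheme with \<open>T = meixner_raise c\<close>.\<close>

definition meixner_op :: "real \<Rightarrow> real poly \<Rightarrow> real poly" where
  "meixner_op c q = fold_coeffs (\<lambda>a r. [:a:] + meixner_raise c r) q 0"

definition meixner_symbol :: "('r::finite \<Rightarrow> real) \<Rightarrow> ('r \<Rightarrow> nat) \<Rightarrow> real poly" where
  "meixner_symbol \<beta> n = (\<Prod>i\<in>UNIV. pochhammer [:\<beta> i, 1:] (n i))"

lemma meixner_raise_0 [simp]: "meixner_raise c 0 = 0"
  by (simp add: meixner_raise_def)

lemma meixner_raise_add: "meixner_raise c (p + q) = meixner_raise c p + meixner_raise c q"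
  by (simp add: meixner_raise_def pcompose_add algebra_simps smult_add_right)

lemma meixner_raise_smult: "meixner_raise c (smult a p) = smult a (meixner_raise c p)"
  by (simp add: meixner_raise_def pcompose_smult smult_diff_right mult.commute)

lemma poly_meixner_raise: "poly (meixner_raise c p) x = x * poly p x - x / c * poly p (x - 1)"
  by (simp add: meixner_raise_def poly_pcompose right_diff_distrib)

lemma meixner_op_0 [simp]: "meixner_op c 0 = 0"
  by (simp add: meixner_op_def)

lemma meixner_op_pCons: "meixner_op c (pCons a q) = [:a:] + meixner_raise c (meixner_op c q)"
  by (cases "a = 0 \<and> q = 0") (auto simp: meixner_op_def)

lemma meixner_op_add: "meixner_op c (p + q) = meixner_op c p + meixner_op c q"
proof (induction p arbitrary: q)
  case (pCons a p)
  show ?case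
  proof (cases q)
    case (pCons b q')
    then show ?thesis
      using pCons.IH[of q'] by (simp add: meixner_op_pCons meixner_raise_add)
  qed
qed simp

lemma meixner_op_smult: "meixner_op c (smult a q) = smult a (meixner_op c q)"
  by (induction q) (simp_all add: meixner_op_pCons meixner_raise_smult smult_add_right)

lemma meixner_op_linear_factor:
  "meixner_op c ([:a, 1:] * q) = smult a (meixner_op c q) + meixner_raise c (meixner_op c q)"
  by (simp add: meixner_op_add meixner_op_smult meixner_op_pCons)

section \<open>Degrees and leading coefficients\<close>

lemma coeff_pcompose_shift:
  fixes p :: "real poly"
  assumes "degree p \<le> n"
  shows "coeff (pcompose p [:a, 1:]) n = coeff p n"
proof (cases "degree p = n")
  case True
  then show ?thesis
    using lead_coeff_comp[of "[:a, 1:]" p] by (simp add: degree_pcompose)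
next
  case False
  then show ?thesis
    using assms by (simp add: coeff_eq_0 degree_pcompose)
qed

lemma degree_meixner_raise_le:
  assumes "degree p \<le> n"
  shows "degree (meixner_raise c p) \<le> Suc n"
  unfolding meixner_raise_def
  using assms by (intro degree_diff_le)
    (auto simp: degree_pcompose intro!: order.trans[OF degree_pCons_le] order.trans[OF degree_smult_le])

text \<open>x p(x) and x p(x - 1) have the same coefficient at \<open>Suc n\<close>, so T multiplies
  the top coefficient by 1 - 1/c.\<close>

lemma coeff_meixner_raise:
  assumes "degree p \<le> n"
  shows "coeff (meixner_raise c p) (Suc n) = (1 - 1 / c) * coeff p n"
  using coeff_pcompose_shift[OF assms, of "-1"] by (simp add: meixner_raise_def algebra_simps)

lemma degree_coeff_meixner_op:
  assumes "degree q \<le> n"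
  shows "degree (meixner_op c q) \<le> n \<and> coeff (meixner_op c q) n = (1 - 1 / c) ^ n * coeff q n"
  using assms
proof (induction q arbitrary: n)
  case (pCons a q)
  show ?case
  proof (cases n)
    case 0
    with pCons.prems have "q = 0"
      by (auto split: if_splits)
    with 0 show ?thesis
      by (simp add: meixner_op_pCons)
  next
    case (Suc m)
    with pCons.prems have "degree q \<le> m"
      by (auto split: if_splits)
    note IH = pCons.IH[OF this]
    have "degree ([:a:] + meixner_raise c (meixner_op c q)) \<le> Suc m"
      by (intro degree_add_le degree_meixner_raise_le) (use IH in auto)
    then show ?thesis
      using coeff_meixner_raise[of "meixner_op c q" m c] IH Suc by (simp add: meixner_op_pCons)
  qed
qed simp

text \<open>As 1 - 1/c is nonzero, T raises the degree of a nonzero polynomial by exactly one, so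
  sending q to q(T) 1 is triangular. This turns any competitor for the Meixner polynomial into a
  symbol whose roots can be counted.\<close>

lemma meixner_op_surj:
  assumes "c \<noteq> 1" "c \<noteq> 0"
  shows "\<exists>q. p = meixner_op c q \<and> degree q \<le> degree p"
proof (induction "degree p" arbitrary: p rule: less_induct)
  case less
  define n where "n = degree p"
  \<comment> \<open>The monomial whose image has the same leading term as p; the factor (1 - 1/c) ^
    n contributed by T is divided out.\<close>
  define m where "m = monom (lead_coeff p / (1 - 1 / c) ^ n) n"
  have nz: "1 - 1 / c \<noteq> 0"
    using assms by (simp add: field_simps)
  have dm: "degree m \<le> n"
    unfolding m_def by (rule degree_monom_le)
  note mm = degree_coeff_meixner_op[OF dm, of c]
  have "coeff (meixner_op c m) n = (1 - 1 / c) ^ n * (lead_coeff p / (1 - 1 / c) ^ n)"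
    using mm by (simp only: m_def coeff_monom if_True refl)
  also have "\<dots> = lead_coeff p"
    using power_not_zero[OF nz, of n] by (metis nonzero_mult_div_cancel_left times_divide_eq_right)
  finally have c0: "coeff (p - meixner_op c m) n = 0"
    by (simp add: n_def)
  have dle: "degree (p - meixner_op c m) \<le> n"
    using mm by (intro degree_diff_le) (auto simp: n_def)
  show ?case
  \<comment> \<open>Constants are treated directly, since cancelling the leading term cannot lower a
    degree of 0.\<close>
  proof (cases "n = 0")
    case True
    then obtain a where "p = [:a:]"
      unfolding n_def by (metis degree_eq_zeroE)
    then show ?thesis
      by (intro exI[of _ "[:a:]"]) (simp add: meixner_op_pCons)
  next
    case False
    then have "degree (p - meixner_op c m) < degree p"
      using dle c0 unfolding n_def
      by (metis leading_coeff_0_iff degree_0 le_neq_implies_less neq0_conv)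
    from less[OF this] obtain q where
      q: "p - meixner_op c m = meixner_op c q" "degree q \<le> degree (p - meixner_op c m)"
      by blast
    have "p = meixner_op c (m + q)"
      using q(1) by (simp add: meixner_op_add algebra_simps)
    moreover have "degree (m + q) \<le> degree p"
      using dm q(2) dle by (intro degree_add_le) (auto simp: n_def)
    ultimately show ?thesis
      by blast
  qed
qed

section \<open>Weights, moments and shifted parameters\<close>

lemma meixner_weight_shift:
  "real k * meixner_weight c b k = b * meixner_weight c (b + 1) k - b * meixner_weight c b k"
proof -
  have "b * pochhammer (b + 1) k = pochhammer b k * (b + real k)"
    by (metis mult.commute pochhammer_rec pochhammer_rec')
  then have "b * pochhammer (b + 1) k * (c ^ k / fact k) = pochhammer b k * (b + real k) * (c ^ k / fact k)"
    by (rule arg_cong)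
  then show ?thesis
    by (simp add: meixner_weight_def algebra_simps)
qed

text \<open>The Pearson equation of the weight; under the sum it turns the shift p(x - 1) in T into
  multiplication by x + b.\<close>

lemma meixner_weight_Suc:
  "real (Suc k) * meixner_weight c b (Suc k) = c * (b + real k) * meixner_weight c b k"
  by (simp add: meixner_weight_def pochhammer_Suc field_simps del: of_nat_Suc)

text \<open>This is the binomial series of (1 - c) powr (-b).\<close>

lemma summable_meixner_weight:
  assumes "0 < c" "c < 1"
  shows "summable (meixner_weight c b)"
proof -
  have "summable (\<lambda>k. ((-b) gchoose k) * (-c) ^ k)"
    using gen_binomial_real[of "-c" "-b"] assms by (auto simp: summable_def)
  moreover have "((-b) gchoose k) * (-c) ^ k = meixner_weight c b k" for k
    by (simp add: gbinomial_pochhammer meixner_weight_def power_minus[of c])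
  ultimately show ?thesis
    by simp
qed

text \<open>\<open>meixner_weight_shift\<close> trades a factor k for the parameter b + 1, hence the
  induction with b arbitrary.\<close>

lemma summable_poly_meixner_weight:
  assumes "0 < c" "c < 1"
  shows "summable (\<lambda>k. poly p (real k) * meixner_weight c b k)"
proof (induction p arbitrary: b)
  case (pCons a p)
  have "poly (pCons a p) (real k) * meixner_weight c b k = a * meixner_weight c b k +
      (b * (poly p (real k) * meixner_weight c (b + 1) k) - b * (poly p (real k) * meixner_weight c b k))"
    for k
  proof -
    have "poly (pCons a p) (real k) * meixner_weight c b k =
        a * meixner_weight c b k + poly p (real k) * (real k * meixner_weight c b k)"
      by (simp add: algebra_simps)
    then show ?thesis
      unfolding meixner_weight_shift by (simp only: right_diff_distrib mult_ac)
  qed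
  then show ?case
    by (simp only:) (intro summable_add summable_diff summable_mult pCons summable_meixner_weight assms)
qed simp

definition meixner_functional :: "real \<Rightarrow> real \<Rightarrow> (nat \<Rightarrow> real) \<Rightarrow> real" where
  "meixner_functional c b f = (\<Sum>k. f k * meixner_weight c b k)"

text \<open>Reindexing the p(x - 1) term by one and applying \<open>meixner_weight_Suc\<close> turns
  it into (k + b) p(k) against the weight; subtracted from k p(k), it leaves only -b p(k).\<close>

lemma meixner_functional_raise:
  assumes "0 < c" "c < 1"
  shows "meixner_functional c b (\<lambda>k. poly (meixner_raise c p) (real k)) =
    - b * meixner_functional c b (\<lambda>k. poly p (real k))"
proof -
  let ?w = "meixner_weight c b"
  have s1: "(\<lambda>k. poly q (real k) * ?w k) sums (\<Sum>k. poly q (real k) * ?w k)" for q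
    using summable_poly_meixner_weight[OF assms] by (rule summable_sums)
  define f where "f = (\<lambda>k. real k / c * poly p (real k - 1) * ?w k)"
  have "f (Suc k) = poly ([:b, 1:] * p) (real k) * ?w k" for k
  proof -
    have "f (Suc k) = poly p (real k) / c * (real (Suc k) * ?w (Suc k))"
      by (simp add: f_def)
    also have "\<dots> = poly ([:b, 1:] * p) (real k) * ?w k"
      unfolding meixner_weight_Suc using assms by (simp add: field_simps)
    finally show ?thesis .
  qed
  then have "(\<lambda>k. f (Suc k)) sums (\<Sum>k. poly ([:b, 1:] * p) (real k) * ?w k)"
    by (simp only: s1)
  \<comment> \<open>Undoing the index shift produces no boundary term, because the factor k makes f
    0 vanish.\<close>
  then have f: "f sums (\<Sum>k. poly ([:b, 1:] * p) (real k) * ?w k)"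
    by (subst (asm) sums_Suc_iff) (simp add: f_def)
  have "(\<lambda>k. poly ([:0, 1:] * p) (real k) * ?w k - f k) sums
      ((\<Sum>k. poly ([:0, 1:] * p) (real k) * ?w k) - (\<Sum>k. poly ([:b, 1:] * p) (real k) * ?w k))"
    by (intro sums_diff s1 f)
  also have "(\<lambda>k. poly ([:0, 1:] * p) (real k) * ?w k - f k) =
      (\<lambda>k. poly (meixner_raise c p) (real k) * ?w k)"
    by (simp add: fun_eq_iff f_def poly_meixner_raise algebra_simps)
  finally have "meixner_functional c b (\<lambda>k. poly (meixner_raise c p) (real k)) =
      (\<Sum>k. poly ([:0, 1:] * p) (real k) * ?w k) - (\<Sum>k. poly ([:b, 1:] * p) (real k) * ?w k)"
    unfolding meixner_functional_def by (rule sums_unique[symmetric])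
  also have "\<dots> = (\<Sum>k. poly ([:0, 1:] * p) (real k) * ?w k - poly ([:b, 1:] * p) (real k) * ?w k)"
    by (intro suminf_diff summable_poly_meixner_weight assms)
  also have "\<dots> = (\<Sum>k. - b * (poly p (real k) * ?w k))"
    by (simp add: algebra_simps)
  also have "\<dots> = - b * meixner_functional c b (\<lambda>k. poly p (real k))"
    unfolding meixner_functional_def
    by (intro suminf_mult summable_poly_meixner_weight assms)
  finally show ?thesis .
qed

text \<open>Replacing T by -b throughout q(T) leaves q(-b) times the total mass, so orthogonality
  becomes a root condition on q.\<close>

lemma meixner_functional_op:
  assumes "0 < c" "c < 1"
  shows "meixner_functional c b (\<lambda>k. poly (meixner_op c q) (real k)) =
    poly q (- b) * suminf (meixner_weight c b)"
proof (induction q)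
  case 0
  then show ?case
    by (simp add: meixner_functional_def)
next
  case (pCons a q)
  have "meixner_functional c b (\<lambda>k. poly (meixner_op c (pCons a q)) (real k)) =
      (\<Sum>k. a * meixner_weight c b k + poly (meixner_raise c (meixner_op c q)) (real k) * meixner_weight c b k)"
    by (simp add: meixner_functional_def meixner_op_pCons algebra_simps)
  also have "\<dots> = a * suminf (meixner_weight c b) +
      meixner_functional c b (\<lambda>k. poly (meixner_raise c (meixner_op c q)) (real k))"
    unfolding meixner_functional_def
    by (subst suminf_add[symmetric])
      (auto intro!: summable_mult summable_meixner_weight summable_poly_meixner_weight assms
        simp: suminf_mult[OF summable_meixner_weight[OF assms]])
  finally show ?case
    by (simp add: meixner_functional_raise[OF assms] pCons algebra_simps)
qed

lemma suminf_meixner_weight_pos: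
  assumes "0 < c" "c < 1" "0 < b"
  shows "0 < suminf (meixner_weight c b)"
  by (intro suminf_pos summable_meixner_weight assms)
    (use assms in \<open>simp add: meixner_weight_def pochhammer_pos\<close>)

lemma meixner_functional_moment_Suc:
  assumes "0 < c" "c < 1"
  shows "meixner_functional c b (\<lambda>k. poly p (real k) * real k ^ Suc l) =
    b * meixner_functional c (b + 1) (\<lambda>k. poly p (real k) * real k ^ l) -
    b * meixner_functional c b (\<lambda>k. poly p (real k) * real k ^ l)"
proof -
  have s: "summable (\<lambda>k. poly p (real k) * real k ^ l * meixner_weight c a k)" for a
    using summable_poly_meixner_weight[OF assms, of "p * monom 1 l" a] by (simp add: poly_monom)
  have "poly p (real k) * real k ^ Suc l * meixner_weight c b k =
      b * (poly p (real k) * real k ^ l * meixner_weight c (b + 1) k) -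
      b * (poly p (real k) * real k ^ l * meixner_weight c b k)" for k
  proof -
    have "poly p (real k) * real k ^ Suc l * meixner_weight c b k =
        poly p (real k) * real k ^ l * (real k * meixner_weight c b k)"
      by simp
    then show ?thesis
      unfolding meixner_weight_shift by (simp only: right_diff_distrib mult_ac)
  qed
  then have "meixner_functional c b (\<lambda>k. poly p (real k) * real k ^ Suc l) =
      (\<Sum>k. b * (poly p (real k) * real k ^ l * meixner_weight c (b + 1) k) -
        b * (poly p (real k) * real k ^ l * meixner_weight c b k))"
    unfolding meixner_functional_def by simp
  also have "\<dots> = (\<Sum>k. b * (poly p (real k) * real k ^ l * meixner_weight c (b + 1) k)) -
      (\<Sum>k. b * (poly p (real k) * real k ^ l * meixner_weight c b k))"
    by (intro suminf_diff[symmetric] summable_mult s)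
  finally show ?thesis
    unfolding meixner_functional_def by (simp only: suminf_mult[OF s])
qed

text \<open>Each factor k is traded for a difference between the parameters b + 1 and b, so the l-th
  moment is a combination of the zeroth moments at b, ..., b + l.\<close>

lemma meixner_moments_zero_if_shifts:
  assumes "0 < c" "c < 1"
    and "\<And>i. i \<le> l \<Longrightarrow> meixner_functional c (b + real i) (\<lambda>k. poly p (real k)) = 0"
  shows "meixner_functional c b (\<lambda>k. poly p (real k) * real k ^ l) = 0"
  using assms(3)
proof (induction l arbitrary: b)
  case 0
  then show ?case
    using "0"[of 0] by simp
next
  case (Suc l)
  have "meixner_functional c (b + 1) (\<lambda>k. poly p (real k) * real k ^ l) = 0"
    by (rule Suc.IH) (use Suc.prems[of "Suc _"] in \<open>simp add: add_ac\<close>)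
  moreover have "meixner_functional c b (\<lambda>k. poly p (real k) * real k ^ l) = 0"
    by (rule Suc.IH) (use Suc.prems in simp)
  ultimately show ?case
    by (simp only: meixner_functional_moment_Suc[OF assms(1,2)] mult_zero_right diff_zero)
qed

text \<open>The recurrence is solved for the functional at b + 1, dividing by b > 0. Each such step
  uses up one moment, so l steps reach b + l.\<close>

lemma meixner_shifts_zero_if_moments:
  assumes "0 < c" "c < 1" "0 < b"
    and "\<And>i. i \<le> l \<Longrightarrow> meixner_functional c b (\<lambda>k. poly p (real k) * real k ^ i) = 0"
  shows "meixner_functional c (b + real l) (\<lambda>k. poly p (real k)) = 0"
  using assms(3,4)
proof (induction l arbitrary: b)
  case 0
  then show ?case
    using "0"(2)[of 0] by simp
next
  case (Suc l)
  have "meixner_functional c (b + 1 + real l) (\<lambda>k. poly p (real k)) = 0"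
  proof (rule Suc.IH)
    fix i assume "i \<le> l"
    then have "meixner_functional c b (\<lambda>k. poly p (real k) * real k ^ Suc i) = 0"
      "meixner_functional c b (\<lambda>k. poly p (real k) * real k ^ i) = 0"
      by (intro Suc.prems; simp)+
    with meixner_functional_moment_Suc[OF assms(1,2), of b p i]
    show "meixner_functional c (b + 1) (\<lambda>k. poly p (real k) * real k ^ i) = 0"
      using \<open>0 < b\<close> by simp
  qed (use Suc.prems in simp)
  then show ?case
    by (simp add: add_ac)
qed

text \<open>In terms of shifted parameters, \<open>meixner_functional_op\<close> reads the
  conditions off as roots of the symbol at -(\<beta> j + l).\<close>

lemma is_multiple_meixner2_iff:
  assumes "0 < c" "c < 1" "\<And>i. 0 < \<beta> i"
  shows "is_multiple_meixner2 \<beta> c n p \<longleftrightarrow>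
    degree p = (\<Sum>i\<in>UNIV. n i) \<and> lead_coeff p = 1 \<and>
    (\<forall>j. \<forall>l<n j. meixner_functional c (\<beta> j + real l) (\<lambda>k. poly p (real k)) = 0)"
proof -
  have "(\<lambda>k. poly p (real k) * real k ^ l * meixner_weight c (\<beta> j) k) sums 0 \<longleftrightarrow>
      meixner_functional c (\<beta> j) (\<lambda>k. poly p (real k) * real k ^ l) = 0" for j l
    using summable_poly_meixner_weight[OF assms(1,2), of "p * monom 1 l" "\<beta> j"]
    by (simp add: poly_monom meixner_functional_def sums_iff)
  moreover have "(\<forall>l<n j. meixner_functional c (\<beta> j) (\<lambda>k. poly p (real k) * real k ^ l) = 0) \<longleftrightarrow>
      (\<forall>l<n j. meixner_functional c (\<beta> j + real l) (\<lambda>k. poly p (real k)) = 0)" for j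
    using meixner_moments_zero_if_shifts[OF assms(1,2), of _ "\<beta> j" p]
      meixner_shifts_zero_if_moments[OF assms(1,2) assms(3)[of j], of _ p]
    by (meson le_less_trans)
  ultimately show ?thesis
    by (simp add: is_multiple_meixner2_def meixner_weight_def)
qed

section \<open>Roots of the symbol and the formula for the Meixner polynomial\<close>

lemma poly_pochhammer: "poly (pochhammer p n) x = pochhammer (poly p x) n"
  by (induction n) (simp_all add: pochhammer_Suc)

lemma poly_meixner_symbol:
  "poly (meixner_symbol \<beta> n) x = (\<Prod>i\<in>UNIV. pochhammer (\<beta> i + x) (n i))"
  by (simp add: meixner_symbol_def poly_prod poly_pochhammer)

lemma lead_coeff_pochhammer: "lead_coeff (pochhammer [:b :: real, 1:] n) = 1"
proof (induction n)
  case (Suc n)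
  have "pochhammer [:b, 1:] (Suc n) = pochhammer [:b, 1:] n * [:b + real n, 1:]"
    by (simp add: pochhammer_Suc of_nat_poly)
  then have "lead_coeff (pochhammer [:b, 1:] (Suc n)) =
      lead_coeff (pochhammer [:b, 1:] n) * lead_coeff [:b + real n, 1:]"
    by (simp only: lead_coeff_mult)
  with Suc show ?case
    by simp
qed simp

lemma degree_pochhammer: "degree (pochhammer [:b :: real, 1:] n) = n"
proof (induction n)
  case (Suc n)
  have "pochhammer [:b, 1:] (Suc n) = pochhammer [:b, 1:] n * [:b + real n, 1:]"
    by (simp add: pochhammer_Suc of_nat_poly)
  moreover have "pochhammer [:b, 1:] n \<noteq> 0"
    using lead_coeff_pochhammer[of b n] by auto
  ultimately show ?case
    using Suc by (simp add: degree_mult_eq del: mult_pCons_right)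
qed simp

lemma degree_meixner_symbol: "degree (meixner_symbol \<beta> n) = (\<Sum>i\<in>UNIV. n i)"
proof -
  have "pochhammer [:\<beta> i, 1:] (n i) \<noteq> 0" for i
    using lead_coeff_pochhammer[of "\<beta> i" "n i"] by auto
  then show ?thesis
    by (simp add: meixner_symbol_def degree_prod_eq_sum_degree degree_pochhammer)
qed

lemma lead_coeff_meixner_symbol: "lead_coeff (meixner_symbol \<beta> n) = 1"
  by (simp only: meixner_symbol_def lead_coeff_prod lead_coeff_pochhammer prod.neutral_const)

text \<open>A collision of nodes with different j would make \<beta> i - \<beta> j an integer. The
  count serves to exceed the degree of q in the uniqueness argument.\<close>

lemma card_shift_nodes:
  fixes \<beta> :: "'r::finite \<Rightarrow> real"
  assumes "\<And>i j. i \<noteq> j \<Longrightarrow> \<beta> i - \<beta> j \<notin> \<int>"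
  shows "card {- (\<beta> j + real l) |j l. l < n j} = (\<Sum>i\<in>UNIV. n i)"
proof -
  have "{- (\<beta> j + real l) |j l. l < n j} = (\<lambda>(j, l). - (\<beta> j + real l)) ` (SIGMA j:UNIV. {..<n j})"
    by auto
  moreover have "inj_on (\<lambda>(j, l). - (\<beta> j + real l)) (SIGMA j:UNIV. {..<n j})"
  proof (rule inj_onI, clarify)
    fix i k j l
    assume "- (\<beta> i + real k) = - (\<beta> j + real l)"
    then have "\<beta> i - \<beta> j = of_int (int l - int k)"
      by simp
    then have "i = j"
      using assms[of i j] by (metis Ints_of_int)
    then show "i = j \<and> k = l"
      using \<open>- (\<beta> i + real k) = - (\<beta> j + real l)\<close> by simp
  qed
  ultimately show ?thesis
    by (simp add: card_image)
qed

text \<open>Existence: the symbol vanishes at every node. Uniqueness: the difference of two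
  solutions is q(T) 1 with q of degree below |n|, yet q vanishes at |n| distinct nodes. The factor c
  / (c - 1) inverts 1 - 1/c and makes the polynomial monic.\<close>

theorem multiple_meixner2_eq:
  fixes \<beta> :: "'r::finite \<Rightarrow> real"
  assumes c: "0 < c" "c < 1" and \<beta>: "\<And>i. 0 < \<beta> i"
    and diff: "\<And>i j. i \<noteq> j \<Longrightarrow> \<beta> i - \<beta> j \<notin> \<int>"
  shows "multiple_meixner2 \<beta> c n =
    smult ((c / (c - 1)) ^ (\<Sum>i\<in>UNIV. n i)) (meixner_op c (meixner_symbol \<beta> n))" (is "_ = ?M")
  unfolding multiple_meixner2_def
proof (rule the_equality)
  let ?N = "\<Sum>i\<in>UNIV. n i"
  let ?q = "smult ((c / (c - 1)) ^ ?N) (meixner_symbol \<beta> n)"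
  have M: "?M = meixner_op c ?q"
    by (simp add: meixner_op_smult)
  have "degree ?q \<le> ?N"
    by (simp add: degree_meixner_symbol)
  note dM = degree_coeff_meixner_op[OF this, of c]
  have "coeff (meixner_symbol \<beta> n) ?N = 1"
    using lead_coeff_meixner_symbol[of \<beta> n] by (simp add: degree_meixner_symbol)
  then have "coeff ?M ?N = ((1 - 1 / c) * (c / (c - 1))) ^ ?N"
    using dM M by (simp only: power_mult_distrib coeff_smult mult_1_right)
  also have "(1 - 1 / c) * (c / (c - 1)) = 1"
    using c by (simp add: field_simps)
  finally have cM: "coeff ?M ?N = 1"
    by simp
  moreover have "degree ?M = ?N"
    using dM cM M by (metis le_antisym le_degree zero_neq_one)
  moreover have "meixner_functional c (\<beta> j + real l) (\<lambda>k. poly ?M (real k)) = 0" if "l < n j" for j l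
  proof -
    \<comment> \<open>The rising factorial starts at -l and passes through 0 because l < n
      j.\<close>
    have "pochhammer (\<beta> j + - (\<beta> j + real l)) (n j) = 0"
      using that by (auto simp: pochhammer_eq_0_iff)
    then have "poly (meixner_symbol \<beta> n) (- (\<beta> j + real l)) = 0"
      unfolding poly_meixner_symbol by (intro prod_zero bexI[of _ j]) auto
    then have "poly ?q (- (\<beta> j + real l)) = 0"
      by (simp only: poly_smult mult_zero_right)
    then show ?thesis
      using meixner_functional_op[OF c, of "\<beta> j + real l" ?q] M by simp
  qed
  ultimately show isM: "is_multiple_meixner2 \<beta> c n ?M"
    by (simp add: is_multiple_meixner2_iff[OF c \<beta>])
  fix p
  assume p: "is_multiple_meixner2 \<beta> c n p"
  obtain q where q: "p - ?M = meixner_op c q" "degree q \<le> degree (p - ?M)"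
    using meixner_op_surj[of c "p - ?M"] c by auto
  have root: "poly q (- (\<beta> j + real l)) = 0" if "l < n j" for j l
  proof -
    let ?b = "\<beta> j + real l"
    have "poly q (- ?b) * suminf (meixner_weight c ?b) = meixner_functional c ?b (\<lambda>k. poly (p - ?M) (real k))"
      using meixner_functional_op[OF c] q(1) by metis
    also have "\<dots> = meixner_functional c ?b (\<lambda>k. poly p (real k)) - meixner_functional c ?b (\<lambda>k. poly ?M (real k))"
      unfolding meixner_functional_def poly_diff left_diff_distrib
      by (intro suminf_diff[symmetric] summable_poly_meixner_weight c)
    also have "\<dots> = 0"
      using p isM that by (simp add: is_multiple_meixner2_iff[OF c \<beta>])
    finally show ?thesis
      using suminf_meixner_weight_pos[OF c, of ?b] \<beta>[of j] by simp
  qed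
  show "p = ?M"
  proof (rule ccontr)
    assume ne: "p \<noteq> ?M"
    have "p - ?M \<noteq> 0" "degree (p - ?M) \<le> ?N" "coeff (p - ?M) ?N = 0"
      using p isM ne by (auto simp: is_multiple_meixner2_def intro!: degree_diff_le)
    then have "degree (p - ?M) < ?N"
      by (metis leading_coeff_0_iff le_neq_implies_less)
    moreover have "card {- (\<beta> j + real l) |j l. l < n j} = ?N"
      by (rule card_shift_nodes) (rule diff)
    ultimately have "degree q < card {- (\<beta> j + real l) |j l. l < n j}"
      using q(2) by linarith
    then have "q = 0"
      by (intro poly_eqI_degree[of "{- (\<beta> j + real l) |j l. l < n j}"]) (use root in auto)
    with q(1) ne show False
      by simp
  qed
qed

section \<open>Values at natural numbers and convergent majorants\<close>

lemma poly_meixner_op_nat: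
  assumes "c \<noteq> 0"
  shows "poly (meixner_op c q) (real x) =
    (\<Sum>m\<le>x. real (x choose m) * (c - 1) ^ m * poly q (real m)) / c ^ x"
proof (induction q arbitrary: x)
  case (pCons a q)
  let ?S = "\<lambda>x. \<Sum>m\<le>x. real (x choose m) * (c - 1) ^ m * poly q (real m)"
  \<comment> \<open>After division by c ^ x this expands the constant 1 in the eigenfunctions of T,
    with coefficients (c - 1) ^ m.\<close>
  have const: "(\<Sum>m\<le>x. real (x choose m) * (c - 1) ^ m) = c ^ x"
    using binomial_ring[of "c - 1" 1 x] by simp
  have raise: "poly (meixner_raise c (meixner_op c q)) (real x) =
      (\<Sum>m\<le>x. real (x choose m) * (c - 1) ^ m * (real m * poly q (real m))) / c ^ x"
  \<comment> \<open>At x = 0 both sides vanish; otherwise x - 1 is again natural and the induction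
    hypothesis applies there.\<close>
  proof (cases x)
    case (Suc y)
    \<comment> \<open>The eigenvalue equation for binomial(x, m) c powr -x, once the powers of c
      have cancelled against the 1 / c in T.\<close>
    have absorb: "real (Suc y) * (real (Suc y choose m) - real (y choose m)) = real m * real (Suc y choose m)"
      if "m \<le> Suc y" for m
    proof -
      have "real (Suc y - m) * real (Suc y choose m) = real (Suc y) * real (y choose m)"
        using binomial_absorb_comp[of "Suc y" m] by (simp flip: of_nat_mult del: of_nat_Suc)
      then show ?thesis
        using that by (simp add: of_nat_diff algebra_simps)
    qed
    have "poly (meixner_raise c (meixner_op c q)) (real x) =
        real (Suc y) * poly (meixner_op c q) (real (Suc y)) - real (Suc y) / c * poly (meixner_op c q) (real y)"
      by (simp add: Suc poly_meixner_raise)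
    also have "\<dots> = real (Suc y) * (?S (Suc y) - ?S y) / c ^ x"
      unfolding pCons.IH Suc power_Suc using assms
      by (simp only: right_diff_distrib diff_divide_distrib times_divide_eq_left times_divide_eq_right divide_divide_eq_left mult.commute)
    \<comment> \<open>The added term m = Suc y is zero, so both sums run over the same
      range.\<close>
    also have "?S y = (\<Sum>m\<le>Suc y. real (y choose m) * (c - 1) ^ m * poly q (real m))"
      by simp
    also have "real (Suc y) * (?S (Suc y) - \<dots>) =
        (\<Sum>m\<le>Suc y. real (Suc y) * (real (Suc y choose m) - real (y choose m)) * ((c - 1) ^ m * poly q (real m)))"
      unfolding sum_subtractf[symmetric] sum_distrib_left by (simp only: algebra_simps)
    also have "\<dots> = (\<Sum>m\<le>Suc y. real (Suc y choose m) * (c - 1) ^ m * (real m * poly q (real m)))"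
      by (rule sum.cong) (simp_all only: absorb atMost_iff mult_ac)
    finally show ?thesis
      by (simp only: Suc)
  qed (simp add: poly_meixner_raise)
  have "(\<Sum>m\<le>x. real (x choose m) * (c - 1) ^ m * poly (pCons a q) (real m)) =
      a * (\<Sum>m\<le>x. real (x choose m) * (c - 1) ^ m) +
      (\<Sum>m\<le>x. real (x choose m) * (c - 1) ^ m * (real m * poly q (real m)))"
    unfolding sum_distrib_left sum.distrib[symmetric] by (simp add: algebra_simps)
  then show ?case
    using assms by (simp add: meixner_op_pCons raise const add_divide_distrib)
qed simp

lemma pochhammer_mono:
  fixes a b :: real
  assumes "0 < a" "a \<le> b"
  shows "pochhammer a n \<le> pochhammer b n"
  using assms by (simp add: pochhammer_prod prod_mono)

text \<open>Crude bounds suffice: |c - 1| \<le> 1, the symbol is nondecreasing on [0, x], and the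
  binomial coefficients sum to 2 ^ x. The result factors over i.\<close>

lemma abs_poly_meixner_op_nat_le:
  assumes "0 < c" "c < 1" "\<And>i. 0 < \<beta> i"
  shows "\<bar>poly (meixner_op c (meixner_symbol \<beta> n)) (real x)\<bar> \<le>
    (2 / c) ^ x * (\<Prod>i\<in>UNIV. pochhammer (\<beta> i + real x) (n i))"
proof -
  let ?P = "\<lambda>m. \<Prod>i\<in>UNIV. pochhammer (\<beta> i + real m) (n i)"
  have pos: "0 \<le> ?P m" for m
    by (intro prod_nonneg ballI pochhammer_nonneg add_pos_nonneg assms) simp
  have "\<bar>\<Sum>m\<le>x. real (x choose m) * (c - 1) ^ m * ?P m\<bar> \<le>
      (\<Sum>m\<le>x. \<bar>real (x choose m) * (c - 1) ^ m * ?P m\<bar>)"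
    by (rule sum_abs)
  also have "\<dots> \<le> (\<Sum>m\<le>x. real (x choose m) * 1 * ?P x)"
  proof (rule sum_mono)
    fix m assume "m \<in> {..x}"
    then have "?P m \<le> ?P x"
      by (intro prod_mono conjI pochhammer_nonneg pochhammer_mono)
        (auto intro: add_pos_nonneg assms)
    moreover have "\<bar>c - 1\<bar> ^ m \<le> 1"
      using assms by (intro power_le_one) auto
    ultimately show "\<bar>real (x choose m) * (c - 1) ^ m * ?P m\<bar> \<le> real (x choose m) * 1 * ?P x"
      unfolding abs_mult power_abs using pos[of m] by (intro mult_mono) auto
  qed
  also have "\<dots> = 2 ^ x * ?P x"
    by (simp add: sum_distrib_right[symmetric] choose_row_sum flip: of_nat_sum)
  finally show ?thesis
    using assms by (simp add: poly_meixner_op_nat poly_meixner_symbol abs_divide power_divide divide_right_mono)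
qed

text \<open>The ratio (a + x)_k / (a)_k equals (a + k)_x / (a)_x, a polynomial in k, so the terms
  are a polynomial times a Meixner weight with s in place of c.\<close>

lemma summable_pochhammer_square:
  fixes a s :: real
  assumes "0 < a" "0 < s" "s < 1"
  shows "summable (\<lambda>k. (pochhammer (a + real x) k)\<^sup>2 / (fact k * pochhammer a k) * s ^ k)"
proof -
  let ?p = "smult (1 / pochhammer a x) (pochhammer [:a, 1:] x)"
  have "poly ?p (real k) * meixner_weight s (a + real x) k =
      (pochhammer (a + real x) k)\<^sup>2 / (fact k * pochhammer a k) * s ^ k" for k
  proof -
    have "pochhammer a x * pochhammer (a + real x) k = pochhammer a k * pochhammer (a + real k) x"
      by (metis add.commute pochhammer_product')
    moreover have "pochhammer a x > 0" "pochhammer a k > 0"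
      by (simp_all add: pochhammer_pos assms)
    ultimately have "pochhammer (a + real k) x / pochhammer a x = pochhammer (a + real x) k / pochhammer a k"
      by (simp add: field_simps)
    then show ?thesis
      by (simp add: poly_pochhammer meixner_weight_def power2_eq_square mult_ac)
  qed
  then show ?thesis
    using summable_poly_meixner_weight[OF assms(2,3), of ?p "a + real x"] by simp
qed

text \<open>F lies in a box, over which the sum of products factors.\<close>

lemma sum_prod_le_prod_suminf:
  fixes u :: "'r::finite \<Rightarrow> nat \<Rightarrow> real"
  assumes "\<And>i. summable (u i)" "\<And>i k. 0 \<le> u i k" "finite F"
  shows "(\<Sum>n\<in>F. \<Prod>i\<in>UNIV. u i (n i)) \<le> (\<Prod>i\<in>UNIV. suminf (u i))"
proof -
  \<comment> \<open>Inserting 0 keeps the maximum meaningful for empty F.\<close>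
  define N where "N = Max (insert 0 (\<Union>n\<in>F. range n))"
  have "n i \<le> N" if "n \<in> F" for n i
    unfolding N_def by (rule Max_ge) (use that assms(3) in auto)
  then have "F \<subseteq> PiE UNIV (\<lambda>_. {..N})"
    by auto
  then have "(\<Sum>n\<in>F. \<Prod>i\<in>UNIV. u i (n i)) \<le> (\<Sum>n\<in>PiE UNIV (\<lambda>_. {..N}). \<Prod>i\<in>UNIV. u i (n i))"
    by (intro sum_mono2 finite_PiE prod_nonneg) (use assms in auto)
  also have "\<dots> = (\<Prod>i\<in>UNIV. \<Sum>k\<in>{..N}. u i k)"
    by (rule prod_sum_PiE[symmetric]) auto
  also have "\<dots> \<le> (\<Prod>i\<in>UNIV. suminf (u i))"
    by (intro prod_mono conjI sum_nonneg sum_le_suminf) (use assms in auto)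
  finally show ?thesis .
qed

section \<open>The generating function and its singularity at c\<close>

definition scaled_binomial_fps :: "real \<Rightarrow> real \<Rightarrow> real fps" where
  "scaled_binomial_fps a s = Abs_fps (\<lambda>n. (a gchoose n) * s ^ n)"

lemma scaled_binomial_fps_nth [simp]: "fps_nth (scaled_binomial_fps a s) n = (a gchoose n) * s ^ n"
  by (simp add: scaled_binomial_fps_def)

text \<open>With \<open>scaled_binomial_fps a s\<close> as the formal series of (1 + s z) powr a,
  the law of exponents is Vandermonde's convolution.\<close>

lemma scaled_binomial_fps_mult:
  "scaled_binomial_fps a s * scaled_binomial_fps b s = scaled_binomial_fps (a + b) s"
proof (rule fps_ext)
  fix n
  have "fps_nth (scaled_binomial_fps a s * scaled_binomial_fps b s) n =
      (\<Sum>k=0..n. (a gchoose k) * (b gchoose (n - k)) * s ^ n)"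
    unfolding fps_mult_nth by (rule sum.cong) (auto simp: mult_ac simp flip: power_add)
  then show "fps_nth (scaled_binomial_fps a s * scaled_binomial_fps b s) n =
      fps_nth (scaled_binomial_fps (a + b) s) n"
    by (simp add: sum_distrib_right[symmetric] gbinomial_Vandermonde)
qed

lemma scaled_binomial_fps_0: "scaled_binomial_fps 0 s = 1"
  by (rule fps_ext) (simp add: gbinomial_0_left)

lemma scaled_binomial_fps_1: "scaled_binomial_fps 1 s = 1 + fps_const s * fps_X"
proof (rule fps_ext)
  fix n
  have "(1 :: real) gchoose n = real (1 choose n)"
    using binomial_gbinomial[of 1 n, where 'a = real] by simp
  then show "fps_nth (scaled_binomial_fps 1 s) n = fps_nth (1 + fps_const s * fps_X) n"
    by (cases n; cases "n - 1") (auto simp: binomial_eq_0)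
qed

lemma fps_deriv_scaled_binomial_fps:
  "fps_deriv (scaled_binomial_fps a s) = fps_const (a * s) * scaled_binomial_fps (a - 1) s"
proof (rule fps_ext)
  fix n
  have "fps_nth (fps_deriv (scaled_binomial_fps a s)) n = real (Suc n) * (a gchoose Suc n) * s ^ Suc n"
    by simp
  then show "fps_nth (fps_deriv (scaled_binomial_fps a s)) n =
      fps_nth (fps_const (a * s) * scaled_binomial_fps (a - 1) s) n"
    unfolding gbinomial_absorption by simp
qed

text \<open>The series F x on the left satisfies (1 - z) F'(x) = -(x / c) F (x - 1) + (x + b) F x,
  the derivative being in z. Comparing coefficients f n gives (n + 1) f (n + 1) = (b + n + T) f n,
  the recursion of the rising factorial of b + T. As T evaluates at x - 1, x stays arbitrary in the
  induction.\<close>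

lemma meixner_generating_function:
  assumes "c \<noteq> 0"
  shows "fps_nth (scaled_binomial_fps x (- 1 / c) * scaled_binomial_fps (- x - b) (- 1)) n =
    poly (meixner_op c (pochhammer [:b, 1:] n)) x / fact n"
proof (induction n arbitrary: x)
  case 0
  then show ?case
    by (simp add: meixner_op_pCons one_pCons)
next
  case (Suc n)
  define A where "A = (\<lambda>x. scaled_binomial_fps x (- 1 / c))"
  define B where "B = (\<lambda>y. scaled_binomial_fps y (- 1))"
  define F where "F = (\<lambda>x. A x * B (- x - b))"
  define P where "P = (\<lambda>n x. poly (meixner_op c (pochhammer [:b, 1:] n)) x)"
  have "1 - fps_X = B 1"
    by (simp add: B_def scaled_binomial_fps_1 flip: fps_const_neg)
  then have "(1 - fps_X) * B y = B (1 + y)" for y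
    by (simp add: B_def scaled_binomial_fps_mult)
  moreover have "1 + (- x - b) = - (x - 1) - b" "1 + (- x - b - 1) = - x - b"
    by simp_all
  \<comment> \<open>The factor 1 - z raises exponents by one: it produces the one belonging to x - 1
    and undoes the drop caused by differentiation.\<close>
  ultimately have B1: "(1 - fps_X) * B (- x - b) = B (- (x - 1) - b)" "(1 - fps_X) * B (- x - b - 1) = B (- x - b)"
    by metis+
  have "fps_deriv (F x) = fps_const (- x / c) * (A (x - 1) * B (- x - b)) +
      fps_const (x + b) * (A x * B (- x - b - 1))"
    by (simp add: F_def A_def B_def fps_deriv_scaled_binomial_fps algebra_simps)
  then have "(1 - fps_X) * fps_deriv (F x) = fps_const (- x / c) * (A (x - 1) * ((1 - fps_X) * B (- x - b))) +
      fps_const (x + b) * (A x * ((1 - fps_X) * B (- x - b - 1)))"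
    by (simp only: distrib_left mult_ac)
  then have ode: "(1 - fps_X) * fps_deriv (F x) = fps_const (- x / c) * F (x - 1) + fps_const (x + b) * F x"
    by (simp only: B1 F_def)
  have "fps_nth ((1 - fps_X) * fps_deriv (F x)) n =
      real (Suc n) * fps_nth (F x) (Suc n) - real n * fps_nth (F x) n"
    by (cases n) (simp_all add: left_diff_distrib)
  then have "real (Suc n) * fps_nth (F x) (Suc n) =
      (x + b + real n) * fps_nth (F x) n - x / c * fps_nth (F (x - 1)) n"
    unfolding ode by (simp add: algebra_simps)
  moreover have IH: "fps_nth (F y) n = P n y / fact n" for y
    using Suc by (simp add: F_def A_def B_def P_def)
  moreover have "pochhammer [:b, 1:] (Suc n) = [:b + real n, 1:] * pochhammer [:b, 1:] n"
    by (simp add: pochhammer_Suc of_nat_poly mult.commute)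
  then have "P (Suc n) x = (x + b + real n) * P n x - x / c * P n (x - 1)"
    unfolding P_def by (simp only: meixner_op_linear_factor) (simp add: poly_meixner_raise algebra_simps)
  ultimately have "real (Suc n) * fps_nth (F x) (Suc n) = P (Suc n) x / fact n"
    by (simp add: diff_divide_distrib)
  then have "fps_nth (F x) (Suc n) = P (Suc n) x / (real (Suc n) * fact n)"
    by (simp add: field_simps del: of_nat_Suc)
  then show ?case
    by (simp only: F_def A_def B_def P_def fact_Suc)
qed

text \<open>If the coefficients of the generating function decay this fast, then multiplying it by
  \<open>(1 - z) powr (x + b)\<close> makes the binomial series of \<open>(1 - z / c) powr x\<close> converge beyond \<open>c\<close>.\<close>

lemma nat_if_meixner_op_decay:
  assumes c: "0 < c" "c < 1" and r: "c < r" and C: "0 \<le> C"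
    and bound: "\<And>n. (poly (meixner_op c (pochhammer [:b, 1:] n)) x / fact n)\<^sup>2 * (r\<^sup>2) ^ n
      \<le> C * (pochhammer b n / fact n)"
  shows "x \<in> \<nat>"
proof (rule ccontr)
  assume x: "x \<notin> \<nat>"
  have c0: "c \<noteq> 0"
    using c by simp
  define f where "f = (\<lambda>n. poly (meixner_op c (pochhammer [:b, 1:] n)) x / fact n)"
  \<comment> \<open>y < r makes f n * y ^ n bounded, z < y leaves a geometric ratio, z < 1 lets the
    series of (1 - z) powr (x + b) converge, and z > c yields the contradiction.\<close>
  obtain y where y: "c < y" "y < min 1 r"
    using dense[of c "min 1 r"] c r by auto
  obtain z where z: "c < z" "z < y"
    using dense[OF y(1)] by auto
  \<comment> \<open>Chosen so that r ^ 2 * s = y ^ 2; as s < 1, the factor s ^ n absorbs the growth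
    (b)_n / n! allowed by the bound.\<close>
  define s where "s = (y / r)\<^sup>2"
  have s: "0 < s" "s < 1"
    using c y z r by (auto simp: s_def power_less_one_iff abs_square_less_1)
  have "Bseq (meixner_weight s b)"
    using summable_meixner_weight[OF s] by (intro convergent_imp_Bseq summable_LIMSEQ_zero[THEN convergentI])
  then obtain K where K: "\<And>n. \<bar>meixner_weight s b n\<bar> \<le> K"
    by (auto simp: Bseq_def)
  have fy: "\<bar>f n * y ^ n\<bar> \<le> sqrt (C * K)" for n
  proof -
    have "(f n * y ^ n)\<^sup>2 = (f n)\<^sup>2 * (r\<^sup>2) ^ n * s ^ n"
      using c r by (simp add: s_def power_mult_distrib power_divide power_mult[symmetric] mult.commute)
    also have "\<dots> \<le> C * (pochhammer b n / fact n) * s ^ n"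
      unfolding f_def by (intro mult_right_mono bound) (use s in simp)
    also have "\<dots> = C * meixner_weight s b n"
      by (simp add: meixner_weight_def)
    also have "\<dots> \<le> C * K"
      using K[of n] C by (intro mult_left_mono) auto
    finally show ?thesis
      by (metis real_sqrt_abs real_sqrt_le_iff)
  qed
  have "summable (\<lambda>n. norm (f n * z ^ n))"
  proof (rule summable_comparison_test')
    show "summable (\<lambda>n. sqrt (C * K) * (z / y) ^ n)"
      using c z y by (intro summable_mult summable_geometric) auto
    fix n
    have "norm (norm (f n * z ^ n)) = \<bar>f n * y ^ n\<bar> * (z / y) ^ n"
      using c z y by (simp add: abs_mult power_divide)
    also have "\<dots> \<le> sqrt (C * K) * (z / y) ^ n"
      using c z y by (intro mult_right_mono fy) auto
    finally show "norm (norm (f n * z ^ n)) \<le> sqrt (C * K) * (z / y) ^ n" .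
  qed
  moreover have "summable (\<lambda>n. norm (((x + b) gchoose n) * (- 1) ^ n * z ^ n))"
  proof -
    have "summable (\<lambda>n. norm (((x + b) gchoose n) * z ^ n))"
      by (intro abs_summable_in_conv_radius) (use c z y in \<open>auto simp: conv_radius_gchoose\<close>)
    then show ?thesis
      by (simp add: abs_mult)
  qed
  ultimately have "summable (\<lambda>n. \<Sum>k\<le>n. f k * z ^ k * (((x + b) gchoose (n - k)) * (- 1) ^ (n - k) * z ^ (n - k)))"
    by (rule summable_Cauchy_product)
  also have "(\<lambda>n. \<Sum>k\<le>n. f k * z ^ k * (((x + b) gchoose (n - k)) * (- 1) ^ (n - k) * z ^ (n - k))) =
      (\<lambda>n. (x gchoose n) * (- z / c) ^ n)"
  proof
    fix n
    \<comment> \<open>The series with exponent x + b cancels the second factor of the generating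
      function, leaving (1 - X / c) powr x.\<close>
    have "scaled_binomial_fps x (- 1 / c) = scaled_binomial_fps x (- 1 / c) *
        (scaled_binomial_fps (- x - b) (- 1) * scaled_binomial_fps (x + b) (- 1))"
      by (simp add: scaled_binomial_fps_mult scaled_binomial_fps_0)
    then have "(x gchoose n) * (- 1 / c) ^ n =
        fps_nth (scaled_binomial_fps x (- 1 / c) * scaled_binomial_fps (- x - b) (- 1) * scaled_binomial_fps (x + b) (- 1)) n"
      by (metis mult.assoc scaled_binomial_fps_nth)
    also have "\<dots> = (\<Sum>k\<le>n. f k * (((x + b) gchoose (n - k)) * (- 1) ^ (n - k)))"
      unfolding f_def
      by (subst fps_mult_nth) (simp only: meixner_generating_function[OF c0] scaled_binomial_fps_nth atLeast0AtMost)
    finally have "(x gchoose n) * (- 1 / c) ^ n * z ^ n =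
        (\<Sum>k\<le>n. f k * (((x + b) gchoose (n - k)) * (- 1) ^ (n - k)) * z ^ n)"
      by (simp add: sum_distrib_right)
    also have "\<dots> = (\<Sum>k\<le>n. f k * z ^ k * (((x + b) gchoose (n - k)) * (- 1) ^ (n - k) * z ^ (n - k)))"
    proof (rule sum.cong)
      fix k assume "k \<in> {..n}"
      then have "z ^ n = z ^ k * z ^ (n - k)"
        by (simp flip: power_add)
      then show "f k * (((x + b) gchoose (n - k)) * (- 1) ^ (n - k)) * z ^ n =
          f k * z ^ k * (((x + b) gchoose (n - k)) * (- 1) ^ (n - k) * z ^ (n - k))"
        by (simp only: mult_ac)
    qed simp
    finally show "(\<Sum>k\<le>n. f k * z ^ k * (((x + b) gchoose (n - k)) * (- 1) ^ (n - k) * z ^ (n - k))) =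
        (x gchoose n) * (- z / c) ^ n"
      by (simp add: mult.assoc flip: power_mult_distrib)
  qed
  finally have "ereal (norm (- z / c)) \<le> conv_radius (\<lambda>n. x gchoose n)"
    by (intro conv_radius_geI)
  \<comment> \<open>For x outside \<nat> the binomial series has radius of convergence 1, while z /
    c > 1.\<close>
  then show False
    using x c z by (simp add: conv_radius_gchoose)
qed

section \<open>Summation over multi-indices and conclusion\<close>

lemma prod_single_index:
  fixes f :: "'r::finite \<Rightarrow> nat \<Rightarrow> 'a::comm_monoid_mult"
  assumes "\<And>j. f j 0 = 1"
  shows "(\<Prod>j\<in>UNIV. f j (if j = i then k else 0)) = f i k"
proof -
  have "(\<Prod>j\<in>UNIV. f j (if j = i then k else 0)) = (\<Prod>j\<in>UNIV. if j = i then f j k else 1)"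
    by (rule prod.cong) (simp_all add: assms)
  then show ?thesis
    by simp
qed

lemma infsum_ennreal_le:
  fixes g :: "'a \<Rightarrow> real"
  assumes "\<And>n. 0 \<le> g n" "\<And>F. finite F \<Longrightarrow> sum g F \<le> C"
  shows "(\<Sum>\<^sub>\<infinity>n. ennreal (g n)) \<le> ennreal C"
  by (intro infsum_le_finite_sums nonneg_summable_on_complete)
    (simp_all add: sum_ennreal assms ennreal_leI)

text \<open>One summand is a finite partial sum, and in \<open>ennreal\<close> the infinite sum is
  the supremum of these.\<close>

lemma ennreal_le_infsum: "ennreal (g n) \<le> (\<Sum>\<^sub>\<infinity>n. ennreal (g n))"
  using nonneg_infsum_complete[of UNIV "\<lambda>n. ennreal (g n)"] SUP_upper[of "{n}" "{F. finite F \<and> F \<subseteq> UNIV}" "\<lambda>F. \<Sum>n\<in>F. ennreal (g n)"]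
  by simp

theorem theorem6:
  fixes \<beta> t :: "'r::finite \<Rightarrow> real" and c x :: real
  assumes "0 < c" and "c < 1"
    and "\<And>i. 0 < \<beta> i"
    and "\<And>i j. i \<noteq> j \<Longrightarrow> \<beta> i - \<beta> j \<notin> \<int>"
    and "t \<in> region_A2 c \<inter> (\<Union>i. region_B c i)"
  shows "(x \<in> \<nat> \<longrightarrow> meixner2_series \<beta> c t x < \<infinity>) \<and>
         (x \<notin> \<nat> \<longrightarrow> meixner2_series \<beta> c t x = \<infinity>)"
proof -
  note c = assms(1,2) and \<beta> = assms(3)
  define Q where "Q = (\<lambda>n. poly (meixner_op c (meixner_symbol \<beta> n)) x)"
  define g where "g = (\<lambda>n. (poly (multiple_meixner2 \<beta> c n) x)\<^sup>2
                 / ((\<Prod>i\<in>UNIV. fact (n i)) * (\<Prod>i\<in>UNIV. pochhammer (\<beta> i) (n i)))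
                 * (\<Prod>i\<in>UNIV. t i ^ n i))"
  have series: "meixner2_series \<beta> c t x = (\<Sum>\<^sub>\<infinity>n. ennreal (g n))"
    by (simp add: meixner2_series_def g_def)
  have t: "0 < t i" "t i < ((1 - c) / c)\<^sup>2" for i
    using assms(5) by (auto simp: region_A2_def)
  \<comment> \<open>Absorbs the square of the normalizing factor c / (c - 1) into t; membership in
    \<open>region_A2\<close> becomes s i < 1.\<close>
  define s where "s = (\<lambda>i. (c / (1 - c))\<^sup>2 * t i)"
  have s: "0 < s i" "s i < 1" for i
  proof -
    show "0 < s i"
      using t[of i] c by (simp add: s_def)
    have "s i < (c / (1 - c))\<^sup>2 * ((1 - c) / c)\<^sup>2"
      unfolding s_def using t[of i] c by (intro mult_strict_left_mono) auto
    also have "\<dots> = 1"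
      using c by (simp flip: power_mult_distrib)
    finally show "s i < 1" .
  qed
  have g: "g n = (Q n)\<^sup>2 / ((\<Prod>i\<in>UNIV. fact (n i)) * (\<Prod>i\<in>UNIV. pochhammer (\<beta> i) (n i))) *
      (\<Prod>i\<in>UNIV. s i ^ n i)" for n
  proof -
    have "(c / (c - 1))\<^sup>2 = (c / (1 - c))\<^sup>2"
      by (simp add: power_divide power2_commute)
    moreover have "((c / (c - 1)) ^ (\<Sum>i\<in>UNIV. n i))\<^sup>2 = ((c / (c - 1))\<^sup>2) ^ (\<Sum>i\<in>UNIV. n i)"
      by (simp only: power_mult[symmetric] mult.commute)
    ultimately have "((c / (c - 1)) ^ (\<Sum>i\<in>UNIV. n i))\<^sup>2 = (\<Prod>i\<in>UNIV. ((c / (1 - c))\<^sup>2) ^ n i)"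
      by (simp only: power_sum)
    then show ?thesis
      by (simp add: g_def multiple_meixner2_eq[OF assms(1-4)] Q_def s_def power_mult_distrib prod.distrib)
  qed
  have denom_pos: "0 < (\<Prod>i\<in>UNIV. fact (n i)) * (\<Prod>i\<in>UNIV. pochhammer (\<beta> i) (n i))" for n
    by (intro mult_pos_pos prod_pos) (auto simp: pochhammer_pos \<beta>)
  have s_pos: "0 \<le> (\<Prod>i\<in>UNIV. s i ^ n i)" for n
    using s by (intro prod_nonneg) (auto intro: less_imp_le)
  have g_nonneg: "0 \<le> g n" for n
    unfolding g using denom_pos[of n] s_pos[of n] by (intro mult_nonneg_nonneg divide_nonneg_pos) auto
  show ?thesis
  proof (intro conjI impI)
    assume "x \<in> \<nat>"
    then obtain X where X: "x = real X"
      by (auto elim: Nats_cases)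
    \<comment> \<open>The one-index factors into which the bound on g splits; their series converge
      because s i < 1.\<close>
    define u where "u = (\<lambda>i k. (pochhammer (\<beta> i + real X) k)\<^sup>2 / (fact k * pochhammer (\<beta> i) k) * s i ^ k)"
    have u: "summable (u i)" "0 \<le> u i k" for i k
      using summable_pochhammer_square[OF \<beta> s, of i X] s[of i] pochhammer_pos[OF \<beta>[of i], of k]
      by (simp_all add: u_def)
    have "g n \<le> ((2 / c) ^ X)\<^sup>2 * (\<Prod>i\<in>UNIV. u i (n i))" for n
    proof -
      have "\<bar>Q n\<bar> \<le> (2 / c) ^ X * (\<Prod>i\<in>UNIV. pochhammer (\<beta> i + real X) (n i))"
        unfolding Q_def X by (rule abs_poly_meixner_op_nat_le[OF c \<beta>])
      then have "(Q n)\<^sup>2 \<le> ((2 / c) ^ X * (\<Prod>i\<in>UNIV. pochhammer (\<beta> i + real X) (n i)))\<^sup>2"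
        by (metis abs_ge_zero power2_abs power_mono)
      then have "g n \<le> ((2 / c) ^ X * (\<Prod>i\<in>UNIV. pochhammer (\<beta> i + real X) (n i)))\<^sup>2 /
          ((\<Prod>i\<in>UNIV. fact (n i)) * (\<Prod>i\<in>UNIV. pochhammer (\<beta> i) (n i))) * (\<Prod>i\<in>UNIV. s i ^ n i)"
        unfolding g using denom_pos[of n] s_pos[of n]
        by (intro mult_right_mono divide_right_mono) auto
      also have "\<dots> = ((2 / c) ^ X)\<^sup>2 * (\<Prod>i\<in>UNIV. u i (n i))"
        by (simp add: u_def prod.distrib prod_dividef power_mult_distrib prod_power_distrib)
      finally show ?thesis .
    qed
    then have "sum g F \<le> ((2 / c) ^ X)\<^sup>2 * (\<Prod>i\<in>UNIV. suminf (u i))" if "finite F" for F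
      using sum_prod_le_prod_suminf[OF u that]
      by (intro order.trans[OF sum_mono[of F g "\<lambda>n. ((2 / c) ^ X)\<^sup>2 * (\<Prod>i\<in>UNIV. u i (n i))"]])
        (auto simp: sum_distrib_left[symmetric] intro!: mult_left_mono)
    then have "meixner2_series \<beta> c t x \<le> ennreal (((2 / c) ^ X)\<^sup>2 * (\<Prod>i\<in>UNIV. suminf (u i)))"
      unfolding series by (intro infsum_ennreal_le g_nonneg)
    then show "meixner2_series \<beta> c t x < \<infinity>"
      by (rule le_less_trans) simp
  next
    assume x: "x \<notin> \<nat>"
    obtain i where i: "(1 - c)\<^sup>2 < t i"
      using assms(5) by (auto simp: region_B_def)
    \<comment> \<open>The square root of s i; membership in \<open>region_B c i\<close> amounts to c
      < r.\<close>
    define r where "r = c * sqrt (t i) / (1 - c)"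
    have "1 - c < sqrt (t i)"
      using i c by (intro real_less_rsqrt) auto
    then have "c * (1 - c) < c * sqrt (t i)"
      using c by (intro mult_strict_left_mono)
    then have r: "c < r"
      using c by (simp add: r_def pos_less_divide_eq)
    have r2: "r\<^sup>2 = s i"
      using t[of i] by (simp add: r_def s_def power_mult_distrib power_divide)
    show "meixner2_series \<beta> c t x = \<infinity>"
    proof (rule ccontr)
      assume "meixner2_series \<beta> c t x \<noteq> \<infinity>"
      then obtain C where C: "0 \<le> C" "(\<Sum>\<^sub>\<infinity>n. ennreal (g n)) = ennreal C"
        unfolding series by (cases "\<Sum>\<^sub>\<infinity>n. ennreal (g n)") auto
      have "(poly (meixner_op c (pochhammer [:\<beta> i, 1:] k)) x / fact k)\<^sup>2 * (r\<^sup>2) ^ k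
          \<le> C * (pochhammer (\<beta> i) k / fact k)" for k
      proof -
        \<comment> \<open>Multi-indices supported at i alone suffice; there the symbol is a single
          rising factorial.\<close>
        let ?n = "\<lambda>j. if j = i then k else 0"
        let ?P = "poly (meixner_op c (pochhammer [:\<beta> i, 1:] k)) x"
        have "meixner_symbol \<beta> ?n = pochhammer [:\<beta> i, 1:] k"
          unfolding meixner_symbol_def by (rule prod_single_index) simp
        moreover have "(\<Prod>j\<in>UNIV. fact (?n j)) = (fact k :: real)"
          "(\<Prod>j\<in>UNIV. pochhammer (\<beta> j) (?n j)) = pochhammer (\<beta> i) k"
          "(\<Prod>j\<in>UNIV. s j ^ ?n j) = s i ^ k"
          by (rule prod_single_index; simp)+
        ultimately have gk: "g ?n = ?P\<^sup>2 / (fact k * pochhammer (\<beta> i) k) * s i ^ k"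
          by (simp only: g Q_def)
        have "ennreal (g ?n) \<le> ennreal C"
          using ennreal_le_infsum[of g ?n] C by simp
        then have "g ?n \<le> C"
          using C by simp
        \<comment> \<open>The multiplier changes the denominator k! (\<beta> i)_k into (k!)^2, as
          \<open>nat_if_meixner_op_decay\<close> expects.\<close>
        then have "g ?n * (pochhammer (\<beta> i) k / fact k) \<le> C * (pochhammer (\<beta> i) k / fact k)"
          using pochhammer_pos[OF \<beta>[of i], of k] by (intro mult_right_mono) auto
        also have "g ?n * (pochhammer (\<beta> i) k / fact k) = (?P / fact k)\<^sup>2 * (r\<^sup>2) ^ k"
          unfolding gk r2 using pochhammer_pos[OF \<beta>[of i], of k]
          by (simp add: power_divide power2_eq_square)
        finally show ?thesis .
      qed
      from nat_if_meixner_op_decay[OF c r C(1) this] x show False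
        by simp
    qed
  qed
qed

end
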